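(* Let $\mathbb{K}\in\{\mathbb{R},\mathbb{C}\}$, let $d\ge 2$, let $n_1 \le \dots \le n_d$ be positive integers, and let $\mathbf{X} \in \mathbb{K}^{n_1 \times \dots \times n_d}$, $\mathbf{X} \neq 0$. The following are equivalent: (a) $\mathbf{X}$ is a scalar multiple of an orthogonal (if $\mathbb{K}=\mathbb{R}$), resp. unitary (if $\mathbb{K}=\mathbb{C}$), tensor; (b) $\displaystyle \frac{\| \mathbf{X} \|_2}{\| \mathbf{X} \|_F} = \frac{1}{\sqrt{\prod_{\mu =1}^{d-1} n_\mu}}$; (c) $\displaystyle \frac{\| \mathbf{X} \|_*}{\| \mathbf{X} \|_F} = \sqrt{\prod_{\mu =1}^{d-1} n_\mu}$.
   Context: $\mathbb{K}^{n_1\times\dots\times n_d}$ is the space of $d$-way arrays (tensors) $[\mathbf{X}(i_1,\dots,i_d)]$ with entries in $\mathbb{K}$. The Frobenius inner product is $\langle \mathbf{X},\mathbf{Y}\rangle_F=\sum_{i_1,\dots,i_d}\overline{\mathbf{X}(i_1,\dots,i_d)}\,\mathbf{Y}(i_1,\dots,i_d)$, with induced norm $\|\cdot\|_F$. An elementary tensor is one of the form $u^1\otimes\dots\otimes u^d$ with $u^\mu\in\mathbb{K}^{n_\mu}$, having entries $u^1(i_1)\cdots u^d(i_d)$; $\mathcal{C}_1$ denotes the set of elementary tensors. The spectral norm is $\|\mathbf{X}\|_2=\max\{|\langle \mathbf{X},u^1\otimes\dots\otimes u^d\rangle_F| : u^\mu\in\mathbb{K}^{n_\mu},\ \|u^\mu\|=1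 \text{ (Euclidean norm)}\}$. The nuclear norm is $\|\mathbf{X}\|_*=\inf\{\sum_k\|\mathbf{Z}_k\|_F : \mathbf{X}=\sum_k\mathbf{Z}_k \text{ (finite sum)},\ \mathbf{Z}_k\in\mathcal{C}_1\}$. For $u\in\mathbb{K}^{n_1}$, the mode-1 contraction $\mathbf{X}\times_1 u\in\mathbb{K}^{n_2\times\dots\times n_d}$ has entries $\sum_{i=1}^{n_1}u(i)\,\mathbf{X}(i,i_2,\dots,i_d)$ (no complex conjugation). Orthogonal (for $\mathbb{K}=\mathbb{R}$) and unitary (for $\mathbb{K}=\mathbb{C}$) tensors are defined recursively: a tensor of order one, i.e. a vector, is orthogonal (resp. unitary) if its Euclidean norm equals one; for $n_1\le\dots\le n_d$, a tensor $\mathbf{X}\in\mathbb{K}^{n_1\times\dots\times n_d}$ of order $d\ge2$ is orthogonal (resp. unitary) if for every unit vector $u\in\mathbb{K}^{n_1}$ the order-$(d-1)$ tensor $\mathbf{X}\times_1u$ is orthogonal (resp. unitary). *)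

theory Defs
  imports "HOL-Analysis.Analysis" "Jordan_Normal_Form.Conjugate"
begin

text \<open>
  The dimensions $n_1,\dots,n_d$ form a list \<open>ns\<close>. A tensor is a function on multi-indices, which
  are lists with 0-based entries; membership in \<open>tensors ns\<close> requires it to vanish outside the index
  range, so that equality of functions is equality of arrays. Vectors of length \<open>n\<close> are functions
  on \<open>nat\<close> of which only the values below \<open>n\<close> are ever used.

  The scalar type is meant to be \<open>real\<close> or \<open>complex\<close>, where \<open>conjugate\<close> is the identity or \<open>cnj\<close>.
\<close>

definition index_set :: "nat list \<Rightarrow> nat list set" where
  "index_set ns = {is. list_all2 (<) is ns}"

definition tensors :: "nat list \<Rightarrow> (nat list \<Rightarrow> 'a::zero) set" where
  "tensors ns = {X. \<forall>is. is \<notin> index_set ns \<longrightarrow> X is = 0}"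

definition frob_inner ::
    "nat list \<Rightarrow> (nat list \<Rightarrow> 'a) \<Rightarrow> (nat list \<Rightarrow> 'a) \<Rightarrow> 'a::{real_normed_field, conjugatable_field}" where
  "frob_inner ns X Y = (\<Sum>is\<in>index_set ns. conjugate (X is) * Y is)"

definition frob_norm :: "nat list \<Rightarrow> (nat list \<Rightarrow> 'a::real_normed_field) \<Rightarrow> real" where
  "frob_norm ns X = L2_set (\<lambda>is. norm (X is)) (index_set ns)"

text \<open>The Frobenius norm is the one induced by the inner product.\<close>

lemma frob_norm_induced_real:
  fixes X :: "nat list \<Rightarrow> real"
  shows "frob_norm ns X = sqrt (frob_inner ns X X)"
  by (simp add: frob_norm_def frob_inner_def L2_set_def power2_eq_square)

lemma frob_norm_induced_complex:
  fixes X :: "nat list \<Rightarrow> complex"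
  shows "complex_of_real ((frob_norm ns X)\<^sup>2) = frob_inner ns X X"
  by (simp add: frob_norm_def frob_inner_def L2_set_def sum_nonneg complex_norm_square mult.commute
      flip: of_real_power)

definition vec_norm :: "nat \<Rightarrow> (nat \<Rightarrow> 'a::real_normed_field) \<Rightarrow> real" where
  "vec_norm n u = L2_set (\<lambda>i. norm (u i)) {..<n}"

definition elementary :: "nat list \<Rightarrow> (nat \<Rightarrow> nat \<Rightarrow> 'a::real_normed_field) \<Rightarrow> nat list \<Rightarrow> 'a" where
  "elementary ns u =
     (\<lambda>is. if is \<in> index_set ns then \<Prod>\<mu><length ns. u \<mu> (is ! \<mu>) else 0)"

definition elementary_tensors :: "nat list \<Rightarrow> (nat list \<Rightarrow> 'a::real_normed_field) set" where
  "elementary_tensors ns = range (elementary ns)"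

text \<open>
  If all dimensions are positive, the set below is nonempty and compact, so the supremum is the
  maximum.
\<close>

definition spectral_norm ::
    "nat list \<Rightarrow> (nat list \<Rightarrow> 'a::{real_normed_field, conjugatable_field}) \<Rightarrow> real" where
  "spectral_norm ns X =
     Sup {norm (frob_inner ns X (elementary ns u)) |u. \<forall>\<mu><length ns. vec_norm (ns ! \<mu>) (u \<mu>) = 1}"

definition nuclear_norm :: "nat list \<Rightarrow> (nat list \<Rightarrow> 'a::real_normed_field) \<Rightarrow> real" where
  "nuclear_norm ns X =
     Inf {\<Sum>k<N. frob_norm ns (Z k) |(N::nat) Z.
            (\<forall>k<N. Z k \<in> elementary_tensors ns) \<and> X = (\<lambda>is. \<Sum>k<N. Z k is)}"

definition contract1 ::
    "nat \<Rightarrow> (nat list \<Rightarrow> 'a::real_normed_field) \<Rightarrow> (nat \<Rightarrow> 'a) \<Rightarrow> nat list \<Rightarrow> 'a" where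
  "contract1 n X u = (\<lambda>is. \<Sum>i<n. u i * X (i # is))"

text \<open>
  Orthogonal tensors for scalar type \<open>real\<close>, unitary tensors for \<open>complex\<close>. The notion is only
  intended for nonempty sorted \<open>ns\<close>; the value for the empty list is arbitrary.
\<close>

fun unitary_tensor :: "nat list \<Rightarrow> (nat list \<Rightarrow> 'a::real_normed_field) \<Rightarrow> bool" where
  "unitary_tensor [] X \<longleftrightarrow> False"
| "unitary_tensor [n] X \<longleftrightarrow> frob_norm [n] X = 1"
| "unitary_tensor (n # m # ns) X \<longleftrightarrow>
     (\<forall>u. vec_norm n u = 1 \<longrightarrow> unitary_tensor (m # ns) (contract1 n X u))"

definition multiple_of_unitary :: "nat list \<Rightarrow> (nat list \<Rightarrow> 'a::real_normed_field) \<Rightarrow> bool" where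
  "multiple_of_unitary ns X \<longleftrightarrow>
     (\<exists>c. \<exists>Y\<in>tensors ns. unitary_tensor ns Y \<and> X = (\<lambda>is. c * Y is))"

end

theory Submission
  imports Defs
begin

text \<open>
  Write $P = n_1 \cdots n_{d-1}$, which is \<open>prod_list (butlast ns)\<close>, and let $\sigma$, $\nu$ and $F$
  be the spectral, nuclear and Frobenius norms of $X$. Two inequalities hold for every $X$, and
  (b) and (c) are their equality cases:
  $F \le \sqrt P\, \sigma$ (\<open>frob_norm_le_spectral\<close>) and
  $\nu \le \sqrt P\, F$ (\<open>nuclear_norm_le_frob_norm\<close>).

  (b) implies (a). Contracting the first mode with a unit vector does not increase the spectral
  norm, so the first inequality follows by induction on the order: the slices of $X$ are its
  contractions with the standard basis, and their squared Frobenius norms add up to $F^2$. Let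
  $P' = n_2 \cdots n_{d-1}$ and suppose that equality holds with $\sigma = 1$. The quadratic form
  $Q(u) = P' \|u\|^2 - \|X \times_1 u\|_F^2$ is nonnegative by the inequality for order $d-1$, and
  its trace $n_1 P' - F^2$ vanishes. Hence $Q = 0$, so every contraction with a unit vector is
  again an equality case, and $X$ is unitary by induction. Here $Q = 0$ because, by the
  parallelogram law, the zeros of a nonnegative quadratic form are a subspace, and this one
  contains the standard basis.

  (a) implies (b). A unitary tensor has $F = \sqrt P$, by summing over slices, and $\sigma \le 1$, by
  contracting all modes but the last and applying the Cauchy-Schwarz inequality to the unit vector
  that is left. So $F \ge \sqrt P\, \sigma$, and the first inequality is an equality; scaling does
  not affect this.

  (b) implies (c). Pairing $X$ with any decomposition of itself gives $F^2 \le \sigma \nu$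
  (\<open>spectral_nuclear_duality\<close>), so $\nu \ge \sqrt P\, F$ if $\sigma = F / \sqrt P$.

  (c) implies (b). Although $\nu$ and $\sigma$ are dual norms, a first-order comparison replaces a
  separation argument. For an elementary $Y$ of norm one and small $t > 0$,
  \[ \sqrt P\, F - t = \nu - t \le \|X - tY\|_* \le \sqrt P\, \|X - tY\|_F, \]
  and both ends agree for $t = 0$. Comparing their slopes there gives
  $\mathrm{Re} \langle X, Y \rangle \le F / \sqrt P$, and the phase of $Y$ is free, so
  $\sigma \le F / \sqrt P$ (\<open>spectrally_bounded_if_nuclear_eq\<close>).
\<close>

section \<open>Scalars\<close>

text \<open>
  A common setting for the real and the complex numbers. The one law that ties the conjugation to
  the norm is enough: the parallelogram law and the expansion of squared norms are identities in
  the field that descend to the reals because \<open>of_real\<close> is injective.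
\<close>

class hermitian_field = real_normed_field + conjugatable_field +
  assumes conjugate_mult_self_scaleR: "conjugate x * x = (norm x)\<^sup>2 *\<^sub>R 1"

lemma conjugate_mult_self: "conjugate x * x = of_real ((norm (x::'a::hermitian_field))\<^sup>2)"
  by (simp add: conjugate_mult_self_scaleR of_real_def)

instance real :: hermitian_field
  by standard (simp add: power2_eq_square)

instance complex :: hermitian_field
  by standard (metis complex_norm_square conjugate_complex_def mult.commute of_real_def of_real_power)

text \<open>
  A nonnegative real is of the form $\overline y\, y$, and conjugation only swaps the two factors.
\<close>

lemma conjugate_of_real: "conjugate (of_real r :: 'a::hermitian_field) = of_real r"
proof -
  have nonneg: "conjugate (of_real r :: 'a) = of_real r" if "r \<ge> 0" for r
  proof -
    have "(of_real r :: 'a) = conjugate (of_real (sqrt r)) * of_real (sqrt r)"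
      using that by (simp add: conjugate_mult_self)
    then show ?thesis
      by (metis conjugate_dist_mul conjugate_id mult.commute)
  qed
  show ?thesis
    using nonneg[of r] nonneg[of "-r"] conjugate_neg[of "of_real r :: 'a"]
    by (cases "r \<ge> 0") auto
qed

lemma norm_conjugate: "norm (conjugate x) = norm (x::'a::hermitian_field)"
proof -
  have "(of_real ((norm (conjugate x))\<^sup>2) :: 'a) = of_real ((norm x)\<^sup>2)"
    using conjugate_mult_self[of x] conjugate_mult_self[of "conjugate x"] by (simp add: mult.commute)
  then show ?thesis
    by (metis norm_ge_zero of_real_eq_iff power2_eq_iff_nonneg)
qed

lemma conjugate_diff: "conjugate (x - y) = conjugate x - conjugate (y::'a::conjugatable_ring)"
  by (metis conjugate_dist_add conjugate_neg diff_conv_add_uminus)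

lemma parallelogram:
  "(norm (x + y))\<^sup>2 + (norm (x - y))\<^sup>2 = 2 * (norm x)\<^sup>2 + 2 * (norm (y::'a::hermitian_field))\<^sup>2"
proof -
  have "(of_real ((norm (x + y))\<^sup>2 + (norm (x - y))\<^sup>2) :: 'a)
      = of_real (2 * (norm x)\<^sup>2 + 2 * (norm y)\<^sup>2)"
    unfolding of_real_add of_real_mult conjugate_mult_self[symmetric]
    by (simp add: conjugate_dist_add conjugate_diff algebra_simps)
  then show ?thesis by (simp only: of_real_eq_iff)
qed

section \<open>Tensors mode by mode\<close>

lemma index_set_Nil [simp]: "index_set [] = {[]}"
  by (simp add: index_set_def)

lemma index_set_Cons: "index_set (n # ns) = (\<lambda>(i, is). i # is) ` ({..<n} \<times> index_set ns)"
  by (force simp: index_set_def list_all2_Cons2)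

lemma Cons_mem_index_set [simp]: "i # is \<in> index_set (n # ns) \<longleftrightarrow> i < n \<and> is \<in> index_set ns"
  by (simp add: index_set_def)

lemma finite_index_set [simp]: "finite (index_set ns)"
  by (induction ns) (simp_all add: index_set_Cons)

lemma sum_index_set_Cons:
  "(\<Sum>is\<in>index_set (n # ns). f is) = (\<Sum>i<n. \<Sum>is\<in>index_set ns. f (i # is))"
  unfolding index_set_Cons
  by (subst sum.reindex) (auto simp: inj_on_def sum.cartesian_product case_prod_unfold)

lemma vec_norm_nonneg [simp]: "vec_norm n u \<ge> 0"
  by (simp add: vec_norm_def)

lemma vec_norm_power2: "(vec_norm n u)\<^sup>2 = (\<Sum>i<n. (norm (u i))\<^sup>2)"
  by (simp add: vec_norm_def L2_set_def sum_nonneg)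

lemma frob_norm_nonneg [simp]: "frob_norm ns X \<ge> 0"
  by (simp add: frob_norm_def)

lemma frob_norm_power2: "(frob_norm ns X)\<^sup>2 = (\<Sum>is\<in>index_set ns. (norm (X is))\<^sup>2)"
  by (simp add: frob_norm_def L2_set_def sum_nonneg)

lemma frob_norm_Cons: "(frob_norm (n # ns) X)\<^sup>2 = (\<Sum>i<n. (frob_norm ns (\<lambda>is. X (i # is)))\<^sup>2)"
  by (simp add: frob_norm_power2 sum_index_set_Cons)

lemma frob_norm_cong:
  "(\<And>is. is \<in> index_set ns \<Longrightarrow> X is = Y is) \<Longrightarrow> frob_norm ns X = frob_norm ns Y"
  unfolding frob_norm_def by (rule L2_set_cong) auto

lemma frob_norm_scale: "frob_norm ns (\<lambda>is. c * X is) = norm c * frob_norm ns X"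
  by (simp add: frob_norm_def norm_mult L2_set_right_distrib)

lemma frob_norm_pos:
  assumes "X \<in> tensors ns" "X \<noteq> (\<lambda>_. 0)"
  shows "frob_norm ns X > 0"
proof -
  obtain js where "X js \<noteq> 0" using assms(2) by auto
  moreover from this have "js \<in> index_set ns" using assms(1) by (auto simp: tensors_def)
  ultimately have "frob_norm ns X \<noteq> 0"
    by (auto simp: frob_norm_def L2_set_eq_0_iff)
  then show ?thesis using frob_norm_nonneg[of ns X] by linarith
qed

lemma frob_Cauchy_Schwarz:
  fixes X :: "nat list \<Rightarrow> 'a::hermitian_field"
  shows "norm (frob_inner ns X Y) \<le> frob_norm ns X * frob_norm ns Y"
proof -
  have "norm (frob_inner ns X Y) \<le> (\<Sum>is\<in>index_set ns. \<bar>norm (X is)\<bar> * \<bar>norm (Y is)\<bar>)"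
    unfolding frob_inner_def by (rule sum_norm_le) (simp add: norm_mult norm_conjugate)
  also have "\<dots> \<le> frob_norm ns X * frob_norm ns Y"
    unfolding frob_norm_def by (rule L2_set_mult_ineq)
  finally show ?thesis .
qed

lemma frob_inner_self:
  "frob_inner ns X X = of_real ((frob_norm ns (X :: nat list \<Rightarrow> 'a::hermitian_field))\<^sup>2)"
  unfolding frob_inner_def frob_norm_power2 of_real_sum conjugate_mult_self ..

lemma frob_inner_commute:
  "frob_inner ns Y X = conjugate (frob_inner ns X (Y :: nat list \<Rightarrow> 'a::hermitian_field))"
  unfolding frob_inner_def by (simp add: sum_conjugate conjugate_dist_mul mult.commute)

lemma frob_inner_scale_right: "frob_inner ns X (\<lambda>is. c * Y is) = c * frob_inner ns X Y"
  by (simp add: frob_inner_def sum_distrib_left algebra_simps)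

text \<open>
  Only pairs with a real inner product are needed, because the phase of $Y$ can be adjusted; for
  them the cross term is free of real parts.
\<close>

lemma frob_norm_diff_scaled:
  fixes X :: "nat list \<Rightarrow> 'a::hermitian_field"
  assumes "frob_inner ns X Y = of_real r"
  shows "(frob_norm ns (\<lambda>is. X is - of_real t * Y is))\<^sup>2
    = (frob_norm ns X)\<^sup>2 - 2 * t * r + t\<^sup>2 * (frob_norm ns Y)\<^sup>2"
proof -
  have Y: "frob_inner ns Y X = of_real r"
    using assms frob_inner_commute[of ns Y X] by (simp add: conjugate_of_real)
  have "(of_real ((frob_norm ns (\<lambda>is. X is - of_real t * Y is))\<^sup>2) :: 'a)
      = frob_inner ns (\<lambda>is. X is - of_real t * Y is) (\<lambda>is. X is - of_real t * Y is)"
    by (simp only: frob_inner_self)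
  also have "\<dots> = frob_inner ns X X - of_real t * frob_inner ns X Y - of_real t * frob_inner ns Y X
      + of_real (t\<^sup>2) * frob_inner ns Y Y"
    by (simp add: frob_inner_def conjugate_diff conjugate_dist_mul conjugate_of_real sum_distrib_left
        sum.distrib sum_subtractf algebra_simps power2_eq_square)
  also have "\<dots> = of_real ((frob_norm ns X)\<^sup>2 - 2 * t * r + t\<^sup>2 * (frob_norm ns Y)\<^sup>2)"
    by (simp add: assms Y frob_inner_self)
  finally show ?thesis by (simp only: of_real_eq_iff)
qed

lemma elementary_Nil [simp]: "elementary [] u [] = 1"
  by (simp add: elementary_def)

lemma elementary_Cons [simp]:
  "elementary (n # ns) u (i # is) = (if i < n then u 0 i * elementary ns (\<lambda>\<mu>. u (Suc \<mu>)) is else 0)"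
  by (simp add: elementary_def prod.lessThan_Suc_shift del: prod.lessThan_Suc)

lemma elementary_mem_tensors: "elementary ns u \<in> tensors ns"
  by (simp add: tensors_def elementary_def)

lemma elementary_scale: "elementary ns (\<lambda>\<mu> i. c \<mu> * u \<mu> i) is = (\<Prod>\<mu><length ns. c \<mu>) * elementary ns u is"
  by (simp add: elementary_def prod.distrib)

lemma frob_norm_elementary:
  "frob_norm ns (elementary ns u) = (\<Prod>\<mu><length ns. vec_norm (ns ! \<mu>) (u \<mu>))"
proof (induction ns arbitrary: u)
  case Nil
  then show ?case by (simp add: frob_norm_def)
next
  case (Cons n ns)
  have "(frob_norm (n # ns) (elementary (n # ns) u))\<^sup>2
      = (\<Sum>i<n. (norm (u 0 i) * frob_norm ns (elementary ns (\<lambda>\<mu>. u (Suc \<mu>))))\<^sup>2)"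
    by (simp add: frob_norm_Cons frob_norm_scale)
  also have "\<dots> = (vec_norm n (u 0) * frob_norm ns (elementary ns (\<lambda>\<mu>. u (Suc \<mu>))))\<^sup>2"
    by (simp add: power_mult_distrib vec_norm_power2 sum_distrib_right)
  finally have "frob_norm (n # ns) (elementary (n # ns) u)
      = vec_norm n (u 0) * frob_norm ns (elementary ns (\<lambda>\<mu>. u (Suc \<mu>)))"
    by simp
  then show ?case
    by (simp add: Cons.IH prod.lessThan_Suc_shift del: prod.lessThan_Suc)
qed

text \<open>
  The inner product is conjugate-linear in $X$ while the contraction is linear, which is why the
  first factor of the elementary tensor moves over conjugated.
\<close>

lemma frob_inner_elementary_Cons:
  "frob_inner (n # ns) X (elementary (n # ns) u)
    = frob_inner ns (contract1 n X (\<lambda>i. conjugate (u 0 i))) (elementary ns (\<lambda>\<mu>. u (Suc \<mu>)))"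
  unfolding frob_inner_def sum_index_set_Cons contract1_def
  by (subst sum.swap) (simp add: sum_conjugate conjugate_dist_mul sum_distrib_right sum_distrib_left algebra_simps)

lemma vec_norm_conjugate: "vec_norm n (\<lambda>i. conjugate (u i :: 'a::hermitian_field)) = vec_norm n u"
  by (simp add: vec_norm_def norm_conjugate)

definition unit_vec :: "nat \<Rightarrow> nat \<Rightarrow> 'a::zero_neq_one" where
  "unit_vec i j = (if j = i then 1 else 0)"

lemma vec_norm_unit_vec: "i < n \<Longrightarrow> vec_norm n (unit_vec i) = 1"
  by (simp add: vec_norm_def L2_set_def unit_vec_def if_distrib[of norm] if_distrib[of "\<lambda>x. x\<^sup>2"] cong: if_cong)

lemma contract1_unit_vec: "i < n \<Longrightarrow> contract1 n X (unit_vec i) = (\<lambda>is. X (i # is))"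
  by (simp add: contract1_def unit_vec_def if_distrib[of "\<lambda>x. x * _"] cong: if_cong)

section \<open>Bounding the Frobenius norm by the spectral norm\<close>

text \<open>
  If all dimensions are positive, this says that the spectral norm is at most $s$.
  Quantifying over all elementary tensors and not only over normalised ones makes the predicate
  stable under contraction with vectors of any length, so that inductions need no normalisation.
\<close>

definition spectrally_bounded ::
    "nat list \<Rightarrow> (nat list \<Rightarrow> 'a::{real_normed_field, conjugatable_field}) \<Rightarrow> real \<Rightarrow> bool" where
  "spectrally_bounded ns X s \<longleftrightarrow>
     (\<forall>u. norm (frob_inner ns X (elementary ns u)) \<le> s * frob_norm ns (elementary ns u))"

text \<open>
  An elementary tensor with a zero factor vanishes; any other is a positive multiple of one with
  normalised factors.
\<close>

lemma spectrally_boundedI_unit: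
  fixes X :: "nat list \<Rightarrow> 'a::hermitian_field"
  assumes "\<And>u. (\<forall>\<mu><length ns. vec_norm (ns ! \<mu>) (u \<mu>) = 1)
      \<Longrightarrow> norm (frob_inner ns X (elementary ns u)) \<le> s"
  shows "spectrally_bounded ns X s"
  unfolding spectrally_bounded_def
proof
  fix u :: "nat \<Rightarrow> nat \<Rightarrow> 'a"
  let ?r = "\<lambda>\<mu>. vec_norm (ns ! \<mu>) (u \<mu>)"
  show "norm (frob_inner ns X (elementary ns u)) \<le> s * frob_norm ns (elementary ns u)"
  proof (cases "\<exists>\<mu><length ns. ?r \<mu> = 0")
    case True
    then have "frob_norm ns (elementary ns u) = 0" by (auto simp: frob_norm_elementary)
    then show ?thesis using frob_Cauchy_Schwarz[of ns X "elementary ns u"] by simp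
  next
    case False
    define v where "v = (\<lambda>\<mu> i. of_real (inverse (?r \<mu>)) * u \<mu> i)"
    have "vec_norm (ns ! \<mu>) (v \<mu>) = 1" if "\<mu> < length ns" for \<mu>
      using False that unfolding v_def vec_norm_def norm_mult
      by (simp add: norm_inverse flip: L2_set_right_distrib)
    then have v: "norm (frob_inner ns X (elementary ns v)) \<le> s" by (intro assms) auto
    have "elementary ns u = elementary ns (\<lambda>\<mu> i. of_real (?r \<mu>) * v \<mu> i)"
    proof
      fix "is"
      show "elementary ns u is = elementary ns (\<lambda>\<mu> i. of_real (?r \<mu>) * v \<mu> i) is"
        using False by (auto simp: elementary_def v_def intro!: prod.cong)
    qed
    also have "\<dots> = (\<lambda>is. of_real (\<Prod>\<mu><length ns. ?r \<mu>) * elementary ns v is)"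
      by (rule ext) (simp add: elementary_scale)
    finally have "norm (frob_inner ns X (elementary ns u))
        = (\<Prod>\<mu><length ns. ?r \<mu>) * norm (frob_inner ns X (elementary ns v))"
      by (simp add: frob_inner_scale_right norm_mult prod_nonneg del: of_real_prod)
    also have "\<dots> \<le> (\<Prod>\<mu><length ns. ?r \<mu>) * s"
      using v by (intro mult_left_mono prod_nonneg) auto
    finally show ?thesis by (simp add: frob_norm_elementary mult.commute)
  qed
qed

text \<open>
  An elementary tensor of the contracted space becomes one of the full space when
  $\overline v$ is put in front of it.
\<close>

lemma spectrally_bounded_contract1:
  fixes X :: "nat list \<Rightarrow> 'a::hermitian_field"
  assumes "spectrally_bounded (n # ns) X s"
  shows "spectrally_bounded ns (contract1 n X v) (s * vec_norm n v)"
  unfolding spectrally_bounded_def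
proof
  fix u :: "nat \<Rightarrow> nat \<Rightarrow> 'a"
  let ?w = "case_nat (\<lambda>i. conjugate (v i)) u"
  show "norm (frob_inner ns (contract1 n X v) (elementary ns u))
      \<le> s * vec_norm n v * frob_norm ns (elementary ns u)"
    using assms[unfolded spectrally_bounded_def, rule_format, of ?w]
    by (simp add: frob_inner_elementary_Cons frob_norm_elementary prod.lessThan_Suc_shift
        vec_norm_conjugate mult.assoc del: prod.lessThan_Suc)
qed

lemma spectrally_bounded_scale:
  fixes X :: "nat list \<Rightarrow> 'a::hermitian_field"
  assumes "spectrally_bounded ns X s"
  shows "spectrally_bounded ns (\<lambda>is. c * X is) (norm c * s)"
proof -
  have "norm (frob_inner ns (\<lambda>is. c * X is) Z) = norm c * norm (frob_inner ns X Z)" for Z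
    unfolding frob_inner_commute[of ns _ Z] frob_inner_scale_right norm_conjugate
    by (simp add: norm_mult)
  then show ?thesis
    using assms by (simp add: spectrally_bounded_def mult.assoc mult_left_mono)
qed

text \<open>
  A vector is itself elementary, so it can be tested against itself.
\<close>

lemma spectrally_bounded_vector:
  fixes X :: "nat list \<Rightarrow> 'a::hermitian_field"
  assumes "spectrally_bounded [n] X s"
  shows "(frob_norm [n] X)\<^sup>2 \<le> s\<^sup>2"
proof -
  let ?Z = "elementary [n] (\<lambda>_ i. X [i])"
  have Z: "?Z is = X is" if "is \<in> index_set [n]" for "is"
    using that by (auto simp: index_set_Cons)
  have "frob_inner [n] X ?Z = frob_inner [n] X X"
    unfolding frob_inner_def by (rule sum.cong) (simp_all add: Z)
  moreover have "frob_norm [n] ?Z = frob_norm [n] X" by (rule frob_norm_cong) (rule Z)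
  moreover have "norm (frob_inner [n] X ?Z) \<le> s * frob_norm [n] ?Z"
    using assms unfolding spectrally_bounded_def by blast
  ultimately have "(frob_norm [n] X)\<^sup>2 \<le> s * frob_norm [n] X"
    by (simp add: frob_inner_self del: of_real_power)
  then have "frob_norm [n] X = 0 \<or> frob_norm [n] X \<le> s"
    using mult_le_cancel_right_pos[of "frob_norm [n] X" "frob_norm [n] X" s] frob_norm_nonneg[of "[n]" X]
    by (cases "frob_norm [n] X = 0") (auto simp: power2_eq_square)
  then show ?thesis by (auto intro: power_mono)
qed

text \<open>
  The analogue of ``a positive semidefinite matrix of trace zero is zero'', stated through the
  parallelogram law so that it applies to forms that are not given by a matrix. If $Q(v) = Q(w) = 0$,
  then the two nonnegative numbers $Q(v + w)$ and $Q(v - w)$ add up to zero; hence the zeros of $Q$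
  are closed under sums, and $u$ can be assembled one coordinate at a time.
\<close>

lemma nonneg_quadratic_form_eq_0:
  fixes Q :: "(nat \<Rightarrow> 'a::real_normed_field) \<Rightarrow> real"
  assumes nonneg: "\<And>u. Q u \<ge> 0"
    and parallel: "\<And>u v. Q (\<lambda>i. u i + v i) + Q (\<lambda>i. u i - v i) = 2 * Q u + 2 * Q v"
    and homogeneous: "\<And>c u. Q (\<lambda>i. c * u i) = (norm c)\<^sup>2 * Q u"
    and local: "\<And>u v. (\<And>i. i < n \<Longrightarrow> u i = v i) \<Longrightarrow> Q u = Q v"
    and basis: "\<And>i. i < n \<Longrightarrow> Q (unit_vec i) = 0"
  shows "Q u = 0"
proof -
  have "k \<le> n \<Longrightarrow> Q (\<lambda>i. if i < k then u i else 0) = 0" for k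
  proof (induction k)
    case 0
    show ?case using homogeneous[of 0 "\<lambda>_. 0"] by simp
  next
    case (Suc k)
    let ?v = "\<lambda>i. if i < k then u i else 0" and ?w = "\<lambda>i. u k * unit_vec k i"
    have "(\<lambda>i. if i < Suc k then u i else 0) = (\<lambda>i. ?v i + ?w i)"
      by (auto simp: unit_vec_def less_Suc_eq)
    moreover have "Q ?w = 0" using Suc.prems by (simp add: homogeneous basis)
    then have "Q (\<lambda>i. ?v i + ?w i) = 0"
      using parallel[of ?v ?w] nonneg[of "\<lambda>i. ?v i + ?w i"] nonneg[of "\<lambda>i. ?v i - ?w i"] Suc
      by simp
    ultimately show ?case by simp
  qed
  from this[of n] show ?thesis
    using local[of u "\<lambda>i. if i < n then u i else 0"] by simp
qed

text \<open>
  The slices of $X$ along the first mode are its contractions with the standard basis. Each of the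
  $n_1$ slices inherits the bound $s$, and the square of the Frobenius norm is additive over them.
\<close>

lemma frob_norm_le_spectral:
  fixes X :: "nat list \<Rightarrow> 'a::hermitian_field"
  assumes "ns \<noteq> []" and "spectrally_bounded ns X s"
  shows "(frob_norm ns X)\<^sup>2 \<le> real (prod_list (butlast ns)) * s\<^sup>2"
  using assms
proof (induction ns X arbitrary: s rule: unitary_tensor.induct)
  case (2 n X)
  then show ?case using spectrally_bounded_vector[of n X s] by simp
next
  case (3 n m ns X)
  have "(frob_norm (n # m # ns) X)\<^sup>2
      = (\<Sum>i<n. (frob_norm (m # ns) (contract1 n X (unit_vec i)))\<^sup>2)"
    by (subst frob_norm_Cons) (simp add: contract1_unit_vec)
  also have "\<dots> \<le> (\<Sum>i<n. real (prod_list (butlast (m # ns))) * s\<^sup>2)"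
  proof (rule sum_mono)
    fix i assume "i \<in> {..<n}"
    then have i: "vec_norm n (unit_vec i :: nat \<Rightarrow> 'a) = 1" by (simp add: vec_norm_unit_vec)
    show "(frob_norm (m # ns) (contract1 n X (unit_vec i)))\<^sup>2
        \<le> real (prod_list (butlast (m # ns))) * s\<^sup>2"
      using "3.IH"[OF i] spectrally_bounded_contract1[OF "3.prems"(2), of "unit_vec i"] i by simp
  qed
  finally show ?case by simp
qed simp

text \<open>
  In the equality case no contraction of the first mode with a unit vector can lose norm: the defect
  $Q$ is a nonnegative quadratic form whose values on the standard basis add up to zero. Each such
  contraction is then an equality case of lower order.
\<close>

lemma unitary_if_spectral_eq:
  fixes X :: "nat list \<Rightarrow> 'a::hermitian_field"
  assumes "ns \<noteq> []" and "spectrally_bounded ns X 1"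
    and "(frob_norm ns X)\<^sup>2 = real (prod_list (butlast ns))"
  shows "unitary_tensor ns X"
  using assms
proof (induction ns X rule: unitary_tensor.induct)
  case (2 n X)
  then show ?case by (simp add: power2_eq_1_iff) (use frob_norm_nonneg[of "[n]" X] in linarith)
next
  case (3 n m ns X)
  let ?P = "real (prod_list (butlast (m # ns)))"
  define Q where "Q u = ?P * (vec_norm n u)\<^sup>2 - (frob_norm (m # ns) (contract1 n X u))\<^sup>2" for u
  have bounded: "spectrally_bounded (m # ns) (contract1 n X u) (vec_norm n u)" for u
    using spectrally_bounded_contract1[OF "3.prems"(2), of u] by simp
  have nonneg: "Q u \<ge> 0" for u
    using frob_norm_le_spectral[OF _ bounded] by (simp add: Q_def)
  have Q0: "Q u = 0" for u
  proof (rule nonneg_quadratic_form_eq_0[where n = n and Q = Q])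
    fix u v :: "nat \<Rightarrow> 'a"
    have "contract1 n X (\<lambda>i. u i + v i) is = contract1 n X u is + contract1 n X v is" for "is"
      by (simp add: contract1_def algebra_simps sum.distrib)
    moreover have "contract1 n X (\<lambda>i. u i - v i) is = contract1 n X u is - contract1 n X v is" for "is"
      by (simp add: contract1_def algebra_simps sum_subtractf)
    ultimately have "(frob_norm (m # ns) (contract1 n X (\<lambda>i. u i + v i)))\<^sup>2
        + (frob_norm (m # ns) (contract1 n X (\<lambda>i. u i - v i)))\<^sup>2
        = 2 * (frob_norm (m # ns) (contract1 n X u))\<^sup>2 + 2 * (frob_norm (m # ns) (contract1 n X v))\<^sup>2"
      unfolding frob_norm_power2 sum_distrib_left sum.distrib[symmetric]
      by (intro sum.cong) (simp_all add: parallelogram)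
    moreover have "(vec_norm n (\<lambda>i. u i + v i))\<^sup>2 + (vec_norm n (\<lambda>i. u i - v i))\<^sup>2
        = 2 * (vec_norm n u)\<^sup>2 + 2 * (vec_norm n v)\<^sup>2"
      unfolding vec_norm_power2 sum_distrib_left sum.distrib[symmetric]
      by (intro sum.cong) (simp_all add: parallelogram)
    ultimately show "Q (\<lambda>i. u i + v i) + Q (\<lambda>i. u i - v i) = 2 * Q u + 2 * Q v"
      unfolding Q_def by algebra
  next
    fix c and u :: "nat \<Rightarrow> 'a"
    have "contract1 n X (\<lambda>i. c * u i) is = c * contract1 n X u is" for "is"
      by (simp add: contract1_def algebra_simps sum_distrib_left)
    then have "contract1 n X (\<lambda>i. c * u i) = (\<lambda>is. c * contract1 n X u is)" by blast
    moreover have "vec_norm n (\<lambda>i. c * u i) = norm c * vec_norm n u"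
      by (simp add: vec_norm_def norm_mult L2_set_right_distrib)
    ultimately show "Q (\<lambda>i. c * u i) = (norm c)\<^sup>2 * Q u"
      by (simp add: Q_def frob_norm_scale power_mult_distrib algebra_simps)
  next
    fix u v :: "nat \<Rightarrow> 'a"
    assume "\<And>i. i < n \<Longrightarrow> u i = v i"
    then show "Q u = Q v" by (simp add: Q_def vec_norm_power2 contract1_def)
  next
    \<comment> \<open>This is the trace of \<open>Q\<close>; it vanishes by the hypothesis on the Frobenius norm.\<close>
    have "(\<Sum>i<n. Q (unit_vec i)) = 0"
      using "3.prems"(3) frob_norm_Cons[of n "m # ns" X]
      by (simp add: Q_def sum_subtractf vec_norm_unit_vec contract1_unit_vec)
    then show "Q (unit_vec i) = 0" if "i < n" for i
      using that nonneg by (simp add: sum_nonneg_eq_0_iff)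
  qed (rule nonneg)
  show ?case
    unfolding unitary_tensor.simps
  proof (intro allI impI)
    fix u :: "nat \<Rightarrow> 'a"
    assume u: "vec_norm n u = 1"
    show "unitary_tensor (m # ns) (contract1 n X u)"
      using "3.IH"[OF u] bounded[of u] Q0[of u] u by (simp add: Q_def)
  qed
qed simp

lemma frob_norm_unitary:
  fixes X :: "nat list \<Rightarrow> 'a::hermitian_field"
  assumes "unitary_tensor ns X"
  shows "(frob_norm ns X)\<^sup>2 = real (prod_list (butlast ns))"
  using assms
proof (induction ns X rule: unitary_tensor.induct)
  case (3 n m ns X)
  have "(frob_norm (n # m # ns) X)\<^sup>2
      = (\<Sum>i<n. (frob_norm (m # ns) (contract1 n X (unit_vec i)))\<^sup>2)"
    by (subst frob_norm_Cons) (simp add: contract1_unit_vec)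
  also have "\<dots> = (\<Sum>i<n. real (prod_list (butlast (m # ns))))"
    using 3 by (intro sum.cong) (simp_all add: vec_norm_unit_vec)
  finally show ?case by simp
qed auto

text \<open>
  The definition of a unitary tensor peels off one unit vector at a time, exactly as the pairing
  with an elementary tensor does; at order one the Cauchy-Schwarz inequality remains.
\<close>

lemma spectrally_bounded_unitary:
  fixes X :: "nat list \<Rightarrow> 'a::hermitian_field"
  assumes "unitary_tensor ns X"
  shows "spectrally_bounded ns X 1"
proof (rule spectrally_boundedI_unit)
  fix u :: "nat \<Rightarrow> nat \<Rightarrow> 'a"
  assume "\<forall>\<mu><length ns. vec_norm (ns ! \<mu>) (u \<mu>) = 1"
  with assms show "norm (frob_inner ns X (elementary ns u)) \<le> 1"
  proof (induction ns X arbitrary: u rule: unitary_tensor.induct)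
    case (2 n X)
    have "frob_norm [n] (elementary [n] u) = 1"
      using "2.prems"(2) by (simp add: frob_norm_elementary)
    then show ?case
      using frob_Cauchy_Schwarz[of "[n]" X "elementary [n] u"] "2.prems"(1) by simp
  next
    case (3 n m ns X)
    let ?v = "\<lambda>i. conjugate (u 0 i)"
    have v: "vec_norm n ?v = 1" using "3.prems"(2) by (auto simp: vec_norm_conjugate)
    have "unitary_tensor (m # ns) (contract1 n X ?v)" using "3.prems"(1) v by simp
    moreover have "\<forall>\<mu><length (m # ns). vec_norm ((m # ns) ! \<mu>) (u (Suc \<mu>)) = 1"
      using "3.prems"(2) by (metis Suc_less_eq length_Cons nth_Cons_Suc)
    ultimately show ?case
      unfolding frob_inner_elementary_Cons[of n "m # ns"] by (rule "3.IH"[OF v])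
  qed simp
qed

text \<open>
  The Cauchy-Schwarz inequality makes the set in the definition bounded above, so its supremum is an
  upper bound.
\<close>

lemma spectral_norm_bounded:
  fixes X :: "nat list \<Rightarrow> 'a::hermitian_field"
  shows "spectrally_bounded ns X (spectral_norm ns X)"
proof (rule spectrally_boundedI_unit)
  fix u :: "nat \<Rightarrow> nat \<Rightarrow> 'a"
  assume u: "\<forall>\<mu><length ns. vec_norm (ns ! \<mu>) (u \<mu>) = 1"
  show "norm (frob_inner ns X (elementary ns u)) \<le> spectral_norm ns X"
    unfolding spectral_norm_def
  proof (rule cSup_upper)
    show "bdd_above {norm (frob_inner ns X (elementary ns u)) |u.
        \<forall>\<mu><length ns. vec_norm (ns ! \<mu>) (u \<mu>) = 1}"
    proof (rule bdd_aboveI)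
      fix x assume "x \<in> {norm (frob_inner ns X (elementary ns u)) |u.
        \<forall>\<mu><length ns. vec_norm (ns ! \<mu>) (u \<mu>) = 1}"
      then obtain v where "x = norm (frob_inner ns X (elementary ns v))"
        and "\<forall>\<mu><length ns. vec_norm (ns ! \<mu>) (v \<mu>) = 1" by auto
      then show "x \<le> frob_norm ns X"
        using frob_Cauchy_Schwarz[of ns X "elementary ns v"] by (simp add: frob_norm_elementary)
    qed
  qed (use u in auto)
qed

text \<open>
  Positive dimensions guarantee that unit vectors exist: over the empty set the supremum would be an
  arbitrary number.
\<close>

lemma spectral_norm_least:
  fixes X :: "nat list \<Rightarrow> 'a::hermitian_field"
  assumes "spectrally_bounded ns X s" and "\<forall>n\<in>set ns. n > 0"
  shows "spectral_norm ns X \<le> s"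
  unfolding spectral_norm_def
proof (rule cSup_least)
  have "\<forall>\<mu><length ns. vec_norm (ns ! \<mu>) (unit_vec 0 :: nat \<Rightarrow> 'a) = 1"
    using assms(2) by (simp add: vec_norm_unit_vec)
  then show "{norm (frob_inner ns X (elementary ns u)) |u.
      \<forall>\<mu><length ns. vec_norm (ns ! \<mu>) (u \<mu>) = 1} \<noteq> {}"
    by fastforce
  fix x
  assume "x \<in> {norm (frob_inner ns X (elementary ns u)) |u.
      \<forall>\<mu><length ns. vec_norm (ns ! \<mu>) (u \<mu>) = 1}"
  then obtain u where x: "x = norm (frob_inner ns X (elementary ns u))"
    and "\<forall>\<mu><length ns. vec_norm (ns ! \<mu>) (u \<mu>) = 1" by auto
  then have "frob_norm ns (elementary ns u) = 1" by (simp add: frob_norm_elementary)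
  then show "x \<le> s"
    using assms(1) x unfolding spectrally_bounded_def by (metis mult.right_neutral)
qed

section \<open>Decompositions into elementary tensors\<close>

text \<open>
  The numbers $c$ whose infimum is the nuclear norm. Working with the costs of actual
  decompositions instead of the infimum avoids approximation arguments when decompositions are
  combined.
\<close>

definition decomposition_cost :: "nat list \<Rightarrow> (nat list \<Rightarrow> 'a::real_normed_field) \<Rightarrow> real \<Rightarrow> bool" where
  "decomposition_cost ns X c \<longleftrightarrow>
     (\<exists>(N::nat) Z. (\<forall>k<N. Z k \<in> elementary_tensors ns) \<and> X = (\<lambda>is. \<Sum>k<N. Z k is)
        \<and> c = (\<Sum>k<N. frob_norm ns (Z k)))"

lemma nuclear_norm_eq_Inf: "nuclear_norm ns X = Inf {c. decomposition_cost ns X c}"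
  unfolding nuclear_norm_def decomposition_cost_def by (rule arg_cong[where f = Inf]) auto

lemma decomposition_cost_nonneg: "decomposition_cost ns X c \<Longrightarrow> c \<ge> 0"
  by (auto simp: decomposition_cost_def sum_nonneg)

lemma nuclear_norm_le: "decomposition_cost ns X c \<Longrightarrow> nuclear_norm ns X \<le> c"
  unfolding nuclear_norm_eq_Inf
  by (rule cInf_lower) (auto intro: bdd_belowI[where m = 0] decomposition_cost_nonneg)

lemma decomposition_cost_zero: "decomposition_cost ns (\<lambda>_. 0) 0"
  unfolding decomposition_cost_def by (rule exI[of _ 0]) simp

lemma decomposition_cost_elementary:
  "Z \<in> elementary_tensors ns \<Longrightarrow> decomposition_cost ns Z (frob_norm ns Z)"
  unfolding decomposition_cost_def by (intro exI[of _ 1] exI[of _ "\<lambda>_. Z"]) simp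

lemma sum_append_lessThan:
  fixes h :: "'a \<Rightarrow> 'b::comm_monoid_add" and M N :: nat
  shows "(\<Sum>k<M + N. h (if k < M then f k else g (k - M))) = (\<Sum>k<M. h (f k)) + (\<Sum>k<N. h (g k))"
  by (induction N) (simp_all add: algebra_simps)

lemma decomposition_cost_add:
  assumes "decomposition_cost ns X a" and "decomposition_cost ns Y b"
  shows "decomposition_cost ns (\<lambda>is. X is + Y is) (a + b)"
proof -
  obtain M :: nat and Z where Z: "\<forall>k<M. Z k \<in> elementary_tensors ns"
    "X = (\<lambda>is. \<Sum>k<M. Z k is)" "a = (\<Sum>k<M. frob_norm ns (Z k))"
    using assms(1) unfolding decomposition_cost_def by blast
  obtain N :: nat and W where W: "\<forall>k<N. W k \<in> elementary_tensors ns"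
    "Y = (\<lambda>is. \<Sum>k<N. W k is)" "b = (\<Sum>k<N. frob_norm ns (W k))"
    using assms(2) unfolding decomposition_cost_def by blast
  let ?V = "\<lambda>k. if k < M then Z k else W (k - M)"
  have "\<forall>k<M + N. ?V k \<in> elementary_tensors ns" using Z(1) W(1) by auto
  moreover have "(\<lambda>is. X is + Y is) = (\<lambda>is. \<Sum>k<M + N. ?V k is)"
  proof
    fix "is"
    show "X is + Y is = (\<Sum>k<M + N. ?V k is)"
      using sum_append_lessThan[of "\<lambda>T. T is" M Z W N] unfolding Z(2) W(2) by (rule sym)
  qed
  moreover have "a + b = (\<Sum>k<M + N. frob_norm ns (?V k))"
    using sum_append_lessThan[of "frob_norm ns" M Z W N] unfolding Z(3) W(3) by (rule sym)
  ultimately show ?thesis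
    unfolding decomposition_cost_def by (intro exI[of _ "M + N"] exI[of _ ?V] conjI)
qed

lemma decomposition_cost_sum:
  assumes "\<And>i. i < n \<Longrightarrow> decomposition_cost ns (X i) (c i)"
  shows "decomposition_cost ns (\<lambda>is. \<Sum>i<n. X i is) (\<Sum>i<(n::nat). c i)"
  using assms
proof (induction n)
  case 0
  show ?case using decomposition_cost_zero by simp
next
  case (Suc n)
  then show ?case using decomposition_cost_add[of ns "\<lambda>is. \<Sum>i<n. X i is" _ "X n" "c n"] by simp
qed

text \<open>
  The tensor $e_i \otimes X$.
\<close>

definition place_slice :: "nat \<Rightarrow> (nat list \<Rightarrow> 'a::zero) \<Rightarrow> nat list \<Rightarrow> 'a" where
  "place_slice i X is = (case is of [] \<Rightarrow> 0 | j # js \<Rightarrow> if j = i then X js else 0)"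

lemma place_slice_simps [simp]:
  "place_slice i X [] = 0" "place_slice i X (j # js) = (if j = i then X js else 0)"
  by (simp_all add: place_slice_def)

lemma frob_norm_place_slice:
  assumes "i < n"
  shows "frob_norm (n # ns) (place_slice i X) = frob_norm ns X"
proof -
  have "(frob_norm (n # ns) (place_slice i X))\<^sup>2 = (\<Sum>j<n. if j = i then (frob_norm ns X)\<^sup>2 else 0)"
    unfolding frob_norm_Cons by (intro sum.cong) (auto simp: frob_norm_power2)
  also have "\<dots> = (frob_norm ns X)\<^sup>2" using assms by simp
  finally show ?thesis by simp
qed

lemma place_slice_elementary:
  assumes "i < n"
  shows "place_slice i (elementary ns u) = elementary (n # ns) (case_nat (unit_vec i) u)"
proof
  fix "is"
  show "place_slice i (elementary ns u) is = elementary (n # ns) (case_nat (unit_vec i) u) is"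
  proof (cases "is")
    case Nil
    then show ?thesis by (simp add: elementary_def index_set_def)
  next
    case (Cons j js)
    then show ?thesis using assms by (auto simp: unit_vec_def)
  qed
qed

lemma decomposition_cost_place_slice:
  assumes "decomposition_cost ns X c" and "i < n"
  shows "decomposition_cost (n # ns) (place_slice i X) c"
proof -
  obtain N :: nat and Z where Z: "\<forall>k<N. Z k \<in> elementary_tensors ns"
    "X = (\<lambda>is. \<Sum>k<N. Z k is)" "c = (\<Sum>k<N. frob_norm ns (Z k))"
    using assms(1) unfolding decomposition_cost_def by blast
  have "\<forall>k<N. place_slice i (Z k) \<in> elementary_tensors (n # ns)"
    using Z(1) place_slice_elementary[OF assms(2)] by (fastforce simp: elementary_tensors_def)
  moreover have "place_slice i X = (\<lambda>is. \<Sum>k<N. place_slice i (Z k) is)"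
    by (rule ext) (auto simp: Z(2) place_slice_def split: list.split)
  moreover have "c = (\<Sum>k<N. frob_norm (n # ns) (place_slice i (Z k)))"
    by (simp add: Z(3) frob_norm_place_slice[OF assms(2)])
  ultimately show ?thesis
    unfolding decomposition_cost_def by (intro exI[of _ N] exI[of _ "\<lambda>k. place_slice i (Z k)"]) simp
qed

lemma vector_is_elementary:
  assumes "X \<in> tensors [n]"
  shows "X \<in> elementary_tensors [n]"
proof -
  have "X = elementary [n] (\<lambda>_ i. X [i])"
  proof
    fix "is"
    show "X is = elementary [n] (\<lambda>_ i. X [i]) is"
      using assms by (cases "is"; cases "tl is") (auto simp: tensors_def elementary_def index_set_def)
  qed
  then show ?thesis unfolding elementary_tensors_def by (metis rangeI)
qed

text \<open>
  Split $X$ into its $P$ fibres along the last mode, $X = \sum_i e_{i_1} \otimes \dots \otimes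
  e_{i_{d-1}} \otimes X(i_1, \dots, i_{d-1}, \cdot)$. Each summand is elementary, and by the
  Cauchy-Schwarz inequality the sum of $P$ norms is at most $\sqrt P$ times the root of the sum of
  their squares. The induction does this one mode at a time.
\<close>

lemma cheap_decomposition:
  fixes X :: "nat list \<Rightarrow> 'a::real_normed_field"
  assumes "ns \<noteq> []" and "X \<in> tensors ns"
  shows "\<exists>c \<le> sqrt (real (prod_list (butlast ns))) * frob_norm ns X. decomposition_cost ns X c"
  using assms
proof (induction ns arbitrary: X)
  case (Cons n ns)
  show ?case
  proof (cases "ns = []")
    case True
    then show ?thesis
      using decomposition_cost_elementary[OF vector_is_elementary] Cons.prems(2) by auto
  next
    case False
    let ?P = "real (prod_list (butlast ns))"
    let ?S = "\<lambda>i js. X (i # js)"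
    have "\<exists>c \<le> sqrt ?P * frob_norm ns (?S i). decomposition_cost ns (?S i) c" if "i < n" for i
      using that Cons.prems(2) by (intro Cons.IH False) (simp add: tensors_def)
    then obtain c where c: "\<And>i. i < n \<Longrightarrow> c i \<le> sqrt ?P * frob_norm ns (?S i)"
      "\<And>i. i < n \<Longrightarrow> decomposition_cost ns (?S i) (c i)" by metis
    have "X = (\<lambda>is. \<Sum>i<n. place_slice i (?S i) is)"
    proof
      fix "is"
      show "X is = (\<Sum>i<n. place_slice i (?S i) is)"
        using Cons.prems(2) by (cases "is") (auto simp: tensors_def index_set_def)
    qed
    then have "decomposition_cost (n # ns) X (\<Sum>i<n. c i)"
      using decomposition_cost_sum[of n "n # ns" "\<lambda>i. place_slice i (?S i)" c]
        decomposition_cost_place_slice[OF c(2)] by simp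
    moreover have "(\<Sum>i<n. c i) \<le> sqrt (real (prod_list (butlast (n # ns)))) * frob_norm (n # ns) X"
    proof -
      have "(\<Sum>i<n. c i) \<le> (\<Sum>i<n. sqrt ?P * frob_norm ns (?S i))"
        using c(1) by (intro sum_mono) auto
      also have "\<dots> = sqrt ?P * (\<Sum>i<n. \<bar>1\<bar> * \<bar>frob_norm ns (?S i)\<bar>)"
        by (simp add: sum_distrib_left)
      also have "\<dots> \<le> sqrt ?P * (L2_set (\<lambda>_. 1) {..<n} * L2_set (\<lambda>i. frob_norm ns (?S i)) {..<n})"
        by (intro mult_left_mono L2_set_mult_ineq) simp
      also have "L2_set (\<lambda>i. frob_norm ns (?S i)) {..<n} = frob_norm (n # ns) X"
        unfolding L2_set_def frob_norm_Cons[symmetric] by simp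
      also have "L2_set (\<lambda>_. 1) {..<n} = sqrt (real n)"
        by (simp add: L2_set_constant)
      finally show ?thesis using False by (simp add: real_sqrt_mult algebra_simps)
    qed
    ultimately show ?thesis by blast
  qed
qed simp

lemma nuclear_norm_le_frob_norm:
  fixes X :: "nat list \<Rightarrow> 'a::real_normed_field"
  assumes "ns \<noteq> []" and "X \<in> tensors ns"
  shows "nuclear_norm ns X \<le> sqrt (real (prod_list (butlast ns))) * frob_norm ns X"
  using cheap_decomposition[OF assms] nuclear_norm_le by (meson order_trans)

text \<open>
  Expand the second argument of $\langle X, X \rangle$ by a decomposition
  $X = \sum_k Z_k$ and bound each term by $s \|Z_k\|_F$.
\<close>

lemma spectral_nuclear_duality:
  fixes X :: "nat list \<Rightarrow> 'a::hermitian_field"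
  assumes "spectrally_bounded ns X s" and "s > 0" and "ns \<noteq> []" and "X \<in> tensors ns"
  shows "(frob_norm ns X)\<^sup>2 \<le> s * nuclear_norm ns X"
proof -
  have "(frob_norm ns X)\<^sup>2 / s \<le> c" if "decomposition_cost ns X c" for c
  proof -
    obtain N :: nat and Z where Z: "\<forall>k<N. Z k \<in> elementary_tensors ns"
      "X = (\<lambda>is. \<Sum>k<N. Z k is)" "c = (\<Sum>k<N. frob_norm ns (Z k))"
      using \<open>decomposition_cost ns X c\<close> unfolding decomposition_cost_def by blast
    have "(frob_norm ns X)\<^sup>2 = norm (frob_inner ns X X)"
      by (simp add: frob_inner_self del: of_real_power)
    also have "frob_inner ns X X = frob_inner ns X (\<lambda>is. \<Sum>k<N. Z k is)"
      using Z(2) by simp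
    also have "\<dots> = (\<Sum>k<N. frob_inner ns X (Z k))"
      unfolding frob_inner_def sum_distrib_left by (rule sum.swap)
    also have "norm \<dots> \<le> (\<Sum>k<N. s * frob_norm ns (Z k))"
      using Z(1) assms(1)
      by (intro sum_norm_le) (auto simp: spectrally_bounded_def elementary_tensors_def)
    also have "\<dots> = s * c" by (simp add: Z(3) sum_distrib_left)
    finally show ?thesis using \<open>s > 0\<close> by (simp add: divide_le_eq mult.commute)
  qed
  then have "(frob_norm ns X)\<^sup>2 / s \<le> nuclear_norm ns X"
    unfolding nuclear_norm_eq_Inf using cheap_decomposition[OF assms(3,4)]
    by (intro cInf_greatest) auto
  then show ?thesis using \<open>s > 0\<close> by (simp add: divide_le_eq mult.commute)
qed

lemma elementary_tensors_scale:
  assumes "Z \<in> elementary_tensors ns" and "ns \<noteq> []"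
  shows "(\<lambda>is. c * Z is) \<in> elementary_tensors ns"
proof -
  obtain u where u: "Z = elementary ns u" using assms(1) by (auto simp: elementary_tensors_def)
  \<comment> \<open>The scalar is absorbed by the first factor, which exists as \<open>ns\<close> is nonempty.\<close>
  have "(\<Prod>\<mu><length ns. if \<mu> = 0 then c else 1) = c"
    using assms(2) by simp
  then have "(\<lambda>is. c * Z is) = elementary ns (\<lambda>\<mu> i. (if \<mu> = 0 then c else 1) * u \<mu> i)"
    unfolding u elementary_scale by simp
  then show ?thesis unfolding elementary_tensors_def by (metis rangeI)
qed

text \<open>
  The two sides of the hypothesis agree at $t = 0$ and have the slopes $-2a$ and $-2pr$ there.
\<close>

lemma tangent_bound:
  fixes a p r :: real
  assumes "a > 0" "p \<ge> 0"
    and le: "\<And>t. 0 < t \<Longrightarrow> t < a \<Longrightarrow> (a - t)\<^sup>2 \<le> a\<^sup>2 - 2 * t * (p * r) + p * t\<^sup>2"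
  shows "p * r \<le> a"
proof (rule field_le_epsilon)
  fix e :: real
  assume "e > 0"
  \<comment> \<open>After division by \<open>t\<close> the quadratic remainder is at most \<open>p * t\<close>, hence at most \<open>e\<close>.\<close>
  define t where "t = min (a / 2) (e / (p + 1))"
  have t: "0 < t" "t < a" using assms(1,2) \<open>e > 0\<close> by (auto simp: t_def)
  have "t * (2 * (p * r - a)) \<le> t * (p * t)"
    using le[OF t] by (simp add: power2_eq_square algebra_simps) (use t in \<open>smt (verit) mult_nonneg_nonneg\<close>)
  then have "2 * (p * r - a) \<le> p * t" using t by simp
  also have "\<dots> \<le> (p + 1) * t" using t by (simp add: algebra_simps)
  also have "\<dots> \<le> (p + 1) * (e / (p + 1))"
    using assms(2) by (intro mult_left_mono) (auto simp: t_def)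
  also have "\<dots> = e" using assms(2) by simp
  finally show "p * r \<le> a + e" using \<open>e > 0\<close> by simp
qed

text \<open>
  A decomposition of $X - tY$ that costs at most $\sqrt P\, \|X - tY\|_F$, together with the
  elementary tensor $tY$, decomposes $X$. As $\|X\|_*$ is as large as it can be, this
  forces $\|X - tY\|_F \ge \|X\|_F - t / \sqrt P$ for all $t > 0$, hence bounds the derivative of
  $\|X - tY\|_F$ at $t = 0$, which is $-\mathrm{Re} \langle X, Y \rangle / \|X\|_F$.
\<close>

lemma spectrally_bounded_if_nuclear_eq:
  fixes X :: "nat list \<Rightarrow> 'a::hermitian_field"
  assumes "ns \<noteq> []" and "X \<in> tensors ns" and "frob_norm ns X > 0"
    and P: "P = real (prod_list (butlast ns))" "P > 0"
    and nuc: "nuclear_norm ns X = sqrt P * frob_norm ns X"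
  shows "spectrally_bounded ns X (frob_norm ns X / sqrt P)"
proof (rule spectrally_boundedI_unit)
  fix u :: "nat \<Rightarrow> nat \<Rightarrow> 'a"
  assume unit: "\<forall>\<mu><length ns. vec_norm (ns ! \<mu>) (u \<mu>) = 1"
  let ?F = "frob_norm ns X"
  define z where "z = frob_inner ns X (elementary ns u)"
  show "norm z \<le> ?F / sqrt P"
  proof (cases "z = 0")
    case True
    then show ?thesis using P by simp
  next
    case False
    \<comment> \<open>The phase is chosen so that the inner product with \<open>Y\<close> is the nonnegative real \<open>norm z\<close>.\<close>
    define Y where "Y = (\<lambda>is. (of_real (norm z) / z) * elementary ns u is)"
    have elem: "elementary ns u \<in> elementary_tensors ns" by (simp add: elementary_tensors_def)
    have Y1: "frob_norm ns Y = 1"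
      using False unit unfolding Y_def frob_norm_scale
      by (simp add: norm_divide frob_norm_elementary)
    have XY: "frob_inner ns X Y = of_real (norm z)"
      using False unfolding Y_def frob_inner_scale_right z_def[symmetric] by simp
    have "P * norm z \<le> sqrt P * ?F"
    proof (rule tangent_bound)
      fix t :: real
      assume t: "0 < t" "t < sqrt P * ?F"
      let ?W = "\<lambda>is. X is - of_real t * Y is"
      have "?W \<in> tensors ns"
        using assms(2) elementary_mem_tensors[of ns u] by (simp add: tensors_def Y_def)
      then obtain c where c: "c \<le> sqrt P * frob_norm ns ?W" "decomposition_cost ns ?W c"
        using cheap_decomposition[OF assms(1)] P(1) by blast
      have "(\<lambda>is. of_real t * Y is) \<in> elementary_tensors ns"
        unfolding Y_def by (intro elementary_tensors_scale elem assms(1))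
      then have "decomposition_cost ns (\<lambda>is. of_real t * Y is) t"
        using decomposition_cost_elementary[of "\<lambda>is. of_real t * Y is" ns] t Y1
        by (simp add: frob_norm_scale)
      from nuclear_norm_le[OF decomposition_cost_add[OF c(2) this]]
      have "sqrt P * ?F - t \<le> sqrt P * frob_norm ns ?W" using c(1) nuc by simp
      then have "(sqrt P * ?F - t)\<^sup>2 \<le> (sqrt P * frob_norm ns ?W)\<^sup>2"
        using t by (intro power_mono) auto
      also have "\<dots> = P * (?F\<^sup>2 - 2 * t * norm z + t\<^sup>2)"
        using P frob_norm_diff_scaled[OF XY, of t] by (simp add: power_mult_distrib Y1)
      finally show "(sqrt P * ?F - t)\<^sup>2 \<le> (sqrt P * ?F)\<^sup>2 - 2 * t * (P * norm z) + P * t\<^sup>2"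
        using P by (simp add: power_mult_distrib algebra_simps)
    qed (use assms P in auto)
    then have "sqrt P * (sqrt P * norm z) \<le> sqrt P * ?F"
      using P(2) by (simp add: mult.assoc[symmetric])
    then have "sqrt P * norm z \<le> ?F" using P(2) by simp
    then show ?thesis using P(2) by (simp add: field_simps)
  qed
qed

section \<open>The three equivalent conditions\<close>

text \<open>
  As $F \le \sqrt P\, \sigma$ and $\nu \le \sqrt P\, F$ always hold, (b) and (c) only ask for the
  reverse inequalities. A tensor satisfying (b) is $\sigma$ times the unitary tensor $X / \sigma$.
\<close>

lemma extremal_tensor_equivalences:
  fixes X :: "nat list \<Rightarrow> 'a::hermitian_field"
  assumes "ns \<noteq> []" and pos: "\<forall>n\<in>set ns. n > 0" and "X \<in> tensors ns" and "X \<noteq> (\<lambda>_. 0)"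
    and P: "P = real (prod_list (butlast ns))"
  shows "multiple_of_unitary ns X \<longleftrightarrow> spectral_norm ns X / frob_norm ns X = 1 / sqrt P"
    and "spectral_norm ns X / frob_norm ns X = 1 / sqrt P
      \<longleftrightarrow> nuclear_norm ns X / frob_norm ns X = sqrt P"
proof -
  let ?F = "frob_norm ns X" and ?s = "spectral_norm ns X" and ?N = "nuclear_norm ns X"
  have F: "?F > 0" using frob_norm_pos assms(3,4) by blast
  have "P \<noteq> 0" using pos by (auto simp: P prod_list_zero_iff dest: in_set_butlastD)
  then have "P > 0" using P by linarith
  have s: "spectrally_bounded ns X ?s" by (rule spectral_norm_bounded)
  have "?s \<ge> 0"
  proof -
    have "frob_norm ns (elementary ns (\<lambda>_. unit_vec 0 :: nat \<Rightarrow> 'a)) = 1"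
      using pos by (simp add: frob_norm_elementary vec_norm_unit_vec)
    then show ?thesis using s norm_ge_zero order_trans unfolding spectrally_bounded_def
      by (metis mult.right_neutral)
  qed
  have "?F\<^sup>2 \<le> (sqrt P * ?s)\<^sup>2"
    using frob_norm_le_spectral[OF assms(1) s] \<open>P > 0\<close> by (simp add: P power_mult_distrib)
  then have lower: "?F \<le> sqrt P * ?s"
    using \<open>?s \<ge> 0\<close> \<open>P > 0\<close> by (simp add: power2_le_iff_abs_le)
  have b_iff: "?s / ?F = 1 / sqrt P \<longleftrightarrow> sqrt P * ?s \<le> ?F"
    using F \<open>P > 0\<close> lower by (auto simp: field_simps)
  have upper: "?N \<le> sqrt P * ?F"
    using nuclear_norm_le_frob_norm[OF assms(1,3)] by (simp add: P)
  show "multiple_of_unitary ns X \<longleftrightarrow> ?s / ?F = 1 / sqrt P"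
  proof
    assume "multiple_of_unitary ns X"
    then obtain c Y where Y: "unitary_tensor ns Y" and X: "X = (\<lambda>is. c * Y is)"
      by (auto simp: multiple_of_unitary_def)
    have "?s \<le> norm c"
      using spectral_norm_least[OF spectrally_bounded_scale[OF spectrally_bounded_unitary[OF Y], of c] pos]
      by (simp add: X)
    moreover have "frob_norm ns Y = sqrt P"
      using frob_norm_unitary[OF Y] by (simp add: P real_sqrt_unique)
    then have "?F = norm c * sqrt P" by (simp add: X frob_norm_scale)
    ultimately have "sqrt P * ?s \<le> ?F" using \<open>P > 0\<close> by simp
    then show "?s / ?F = 1 / sqrt P" using b_iff by blast
  next
    assume "?s / ?F = 1 / sqrt P"
    then have eq: "?F = sqrt P * ?s" using b_iff lower by simp
    then have "?s > 0" using F \<open>P > 0\<close> by (simp add: zero_less_mult_iff)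
    let ?Y = "\<lambda>is. of_real (inverse ?s) * X is"
    have "spectrally_bounded ns ?Y 1"
      using spectrally_bounded_scale[OF s, of "of_real (inverse ?s)"] \<open>?s > 0\<close>
      by (simp add: norm_inverse)
    moreover have "(frob_norm ns ?Y)\<^sup>2 = P"
      using \<open>?s > 0\<close> \<open>P > 0\<close> unfolding frob_norm_scale eq
      by (simp add: norm_inverse power_mult_distrib power_inverse)
    ultimately have "unitary_tensor ns ?Y"
      using unitary_if_spectral_eq[OF assms(1)] P by simp
    moreover have "?Y \<in> tensors ns" using assms(3) by (simp add: tensors_def)
    moreover have "X = (\<lambda>is. of_real ?s * ?Y is)" using \<open>?s > 0\<close> by (simp add: field_simps)
    ultimately show "multiple_of_unitary ns X" unfolding multiple_of_unitary_def by blast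
  qed
  show "?s / ?F = 1 / sqrt P \<longleftrightarrow> ?N / ?F = sqrt P"
  proof
    assume "?s / ?F = 1 / sqrt P"
    then have eq: "?F = sqrt P * ?s" using b_iff lower by simp
    then have "?s > 0" using F \<open>P > 0\<close> by (simp add: zero_less_mult_iff)
    have "?s * (sqrt P * ?F) = ?F\<^sup>2" using eq by (simp add: power2_eq_square)
    also have "\<dots> \<le> ?s * ?N" by (rule spectral_nuclear_duality[OF s \<open>?s > 0\<close> assms(1,3)])
    finally have "sqrt P * ?F \<le> ?N" using \<open>?s > 0\<close> by simp
    with upper show "?N / ?F = sqrt P" using F by (simp add: field_simps)
  next
    assume "?N / ?F = sqrt P"
    then have "?N = sqrt P * ?F" using F by (simp add: field_simps)
    from spectral_norm_least[OF spectrally_bounded_if_nuclear_eq[OF assms(1,3) F P \<open>P > 0\<close> this] pos]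
    have "sqrt P * ?s \<le> ?F" using \<open>P > 0\<close> by (simp add: field_simps)
    then show "?s / ?F = 1 / sqrt P" using b_iff by blast
  qed
qed

theorem theorem3p5:
  fixes ns :: "nat list" and d :: nat
  assumes "length ns = d" and "d \<ge> 2" and "sorted ns" and "\<forall>n\<in>set ns. n > 0"
  shows "(\<forall>X :: nat list \<Rightarrow> real. X \<in> tensors ns \<and> X \<noteq> (\<lambda>_. 0) \<longrightarrow>
            (multiple_of_unitary ns X \<longleftrightarrow>
               spectral_norm ns X / frob_norm ns X = 1 / sqrt (real (\<Prod>\<mu><d - 1. ns ! \<mu>))) \<and>
            (spectral_norm ns X / frob_norm ns X = 1 / sqrt (real (\<Prod>\<mu><d - 1. ns ! \<mu>)) \<longleftrightarrow>
               nuclear_norm ns X / frob_norm ns X = sqrt (real (\<Prod>\<mu><d - 1. ns ! \<mu>)))) \<and>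
         (\<forall>X :: nat list \<Rightarrow> complex. X \<in> tensors ns \<and> X \<noteq> (\<lambda>_. 0) \<longrightarrow>
            (multiple_of_unitary ns X \<longleftrightarrow>
               spectral_norm ns X / frob_norm ns X = 1 / sqrt (real (\<Prod>\<mu><d - 1. ns ! \<mu>))) \<and>
            (spectral_norm ns X / frob_norm ns X = 1 / sqrt (real (\<Prod>\<mu><d - 1. ns ! \<mu>)) \<longleftrightarrow>
               nuclear_norm ns X / frob_norm ns X = sqrt (real (\<Prod>\<mu><d - 1. ns ! \<mu>))))"
proof -
  have "ns \<noteq> []" using assms(1,2) by auto
  have "(\<Prod>\<mu><d - 1. ns ! \<mu>) = prod_list (butlast ns)"
    using assms(1) by (simp add: prod.list_conv_set_nth nth_butlast atLeast0LessThan)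
  then show ?thesis
    using extremal_tensor_equivalences[OF \<open>ns \<noteq> []\<close> assms(4) _ _ refl, where 'a = real]
      extremal_tensor_equivalences[OF \<open>ns \<noteq> []\<close> assms(4) _ _ refl, where 'a = complex]
    by (simp only:) blast
qed

end
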